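(* Let $P_8$ be the graph obtained from $K_9$ by deleting the edges of three pairwise vertex-disjoint paths of length 2 (its vertices of degree $6$ are the three middle vertices of these paths). Let $G_8$ be any graph obtained from a copy of $K_5$ by adding pairwise vertex-disjoint copies of $P_8$, where for each copy one edge is added from each of its three vertices of degree $6$ to some vertex of the $K_5$, there are no edges between distinct copies, and enough copies are added so that every vertex of the $K_5$ has degree at least $7$. Then $G_8$ has minimum degree $7$ and has no immersion of $K_8$.
   Context: A graph $H$ is immersed in a graph $G$ if there is an injection $\phi:V(H)\to V(G)$ and an assignment to each edge $uv\in E(H)$ of a path in $G$ between $\phi(u)$ and $\phi(v)$ with paths of distinct edges pairwise edge-disjoint. *)

theory Defs
  imports Main
begin

record 'a ugraph =
  verts :: "'a set"
  edges :: "'a set set"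

text \<open>Finite simple graphs; an edge is the set of its two ends.\<close>

definition simple_graph :: "'a ugraph \<Rightarrow> bool" where
  "simple_graph G \<longleftrightarrow> finite (verts G) \<and> (\<forall>e\<in>edges G. e \<subseteq> verts G \<and> card e = 2)"

definition complete_graph :: "'a set \<Rightarrow> 'a ugraph" where
  "complete_graph S = \<lparr>verts = S, edges = {e. e \<subseteq> S \<and> card e = 2}\<rparr>"

definition degree :: "'a ugraph \<Rightarrow> 'a \<Rightarrow> nat" where
  "degree G v = card {e \<in> edges G. v \<in> e}"

definition min_degree :: "'a ugraph \<Rightarrow> nat" where
  "min_degree G = Min (degree G ` verts G)"

text \<open>A path is the list of its vertices, so its length is one less than the length of the list.\<close>

definition path_edges :: "'a list \<Rightarrow> 'a set set" where
  "path_edges p = {{p ! i, p ! Suc i} |i. Suc i < length p}"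

definition is_path :: "'a ugraph \<Rightarrow> 'a list \<Rightarrow> bool" where
  "is_path G p \<longleftrightarrow> p \<noteq> [] \<and> distinct p \<and> set p \<subseteq> verts G \<and> path_edges p \<subseteq> edges G"

definition path_between :: "'a ugraph \<Rightarrow> 'a list \<Rightarrow> 'a \<Rightarrow> 'a \<Rightarrow> bool" where
  "path_between G p x y \<longleftrightarrow> is_path G p \<and> {hd p, last p} = {x, y}"

text \<open>The paths need only be edge-disjoint: their inner vertices may be shared and may
  be images of vertices of \<open>H\<close>.\<close>

definition immersed :: "'b ugraph \<Rightarrow> 'a ugraph \<Rightarrow> bool" where
  "immersed H G \<longleftrightarrow>
    (\<exists>\<phi> P. inj_on \<phi> (verts H) \<and> \<phi> ` verts H \<subseteq> verts G \<and>
      (\<forall>u v. {u, v} \<in> edges H \<longrightarrow> path_between G (P {u, v}) (\<phi> u) (\<phi> v)) \<and>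
      (\<forall>e\<in>edges H. \<forall>f\<in>edges H. e \<noteq> f \<longrightarrow> path_edges (P e) \<inter> path_edges (P f) = {}))"

text \<open>\<open>C\<close> is a copy of \<open>P\<^sub>8\<close>: \<open>p\<close>, \<open>q\<close>, \<open>r\<close> are the paths whose edges are deleted from \<open>K\<^sub>9\<close>.\<close>

definition is_P8 :: "'a ugraph \<Rightarrow> bool" where
  "is_P8 C \<longleftrightarrow> card (verts C) = 9 \<and>
    (\<exists>p q r.
      (\<forall>s\<in>{p, q, r}. is_path (complete_graph (verts C)) s \<and> length s = 3) \<and>
      set p \<inter> set q = {} \<and> set p \<inter> set r = {} \<and> set q \<inter> set r = {} \<and>
      edges C = edges (complete_graph (verts C)) - (path_edges p \<union> path_edges q \<union> path_edges r))"

definition deg6_verts :: "'a ugraph \<Rightarrow> 'a set" where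
  "deg6_verts C = {v \<in> verts C. degree C v = 6}"

text \<open>\<open>S\<close> is the vertex set of the copy of \<open>K\<^sub>5\<close>, \<open>\<C>\<close> the finite set of the added copies of \<open>P\<^sub>8\<close>,
  and \<open>a\<close> maps each vertex of degree 6 in a copy (degree counted inside that copy) to its
  neighbour in \<open>S\<close>. Several such vertices may have the same neighbour.\<close>

definition is_G8 :: "'a ugraph \<Rightarrow> bool" where
  "is_G8 G \<longleftrightarrow>
    (\<exists>S \<C> a.
      card S = 5 \<and>
      finite \<C> \<and> (\<forall>C\<in>\<C>. is_P8 C \<and> verts C \<inter> S = {}) \<and>
      (\<forall>C\<in>\<C>. \<forall>D\<in>\<C>. C \<noteq> D \<longrightarrow> verts C \<inter> verts D = {}) \<and>
      (\<forall>C\<in>\<C>. \<forall>v\<in>deg6_verts C. a v \<in> S) \<and>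
      verts G = S \<union> (\<Union>C\<in>\<C>. verts C) \<and>
      edges G = edges (complete_graph S) \<union> (\<Union>C\<in>\<C>. edges C)
                \<union> (\<Union>C\<in>\<C>. {{v, a v} |v. v \<in> deg6_verts C}) \<and>
      (\<forall>v\<in>S. degree G v \<ge> 7))"

lemma P8_deg6_verts:
  assumes S: "verts C = S" "card S = 9"
    and d: "distinct [p0, p1, p2, q0, q1, q2, r0, r1, r2]"
    and sub: "{p0, p1, p2, q0, q1, q2, r0, r1, r2} \<subseteq> S"
    and E: "edges C = edges (complete_graph S)
      - (path_edges [p0, p1, p2] \<union> path_edges [q0, q1, q2] \<union> path_edges [r0, r1, r2])"
  shows "deg6_verts C = {p1, q1, r1}"
proof -
  have fin: "finite S" using S(2) card.infinite by force
  have "S = {p0, p1, p2, q0, q1, q2, r0, r1, r2}"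
    using card_subset_eq[OF fin sub] S(2) d by simp
  moreover have pe: "path_edges [x, y, z] = {{x, y}, {y, z}}" for x y z :: 'a
  proof -
    have "{i. Suc i < length [x, y, z]} = {0, 1}" by auto
    moreover have "path_edges [x, y, z]
        = (\<lambda>i. {[x, y, z] ! i, [x, y, z] ! Suc i}) ` {i. Suc i < length [x, y, z]}"
      unfolding path_edges_def by blast
    ultimately show ?thesis by simp
  qed
  ultimately have Sv: "S = {p0, p1, p2, q0, q1, q2, r0, r1, r2}" by simp
  define F where "F = {{p0, p1}, {p1, p2}, {q0, q1}, {q1, q2}, {r0, r1}, {r1, r2}}"
  define N where "N v = {w \<in> S. w \<noteq> v \<and> {v, w} \<notin> F}" for v
  have EF: "edges C = {e. e \<subseteq> S \<and> card e = 2} - F"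
    using E by (simp add: pe F_def complete_graph_def insert_commute Un_assoc)
  have deg: "degree C v = card (N v)" if "v \<in> S" for v
  proof -
    have "{e \<in> edges C. v \<in> e} = (\<lambda>w. {v, w}) ` N v"
    proof (intro equalityI subsetI)
      fix e assume "e \<in> {e \<in> edges C. v \<in> e}"
      then have e: "e \<subseteq> S" "card e = 2" "e \<notin> F" "v \<in> e" unfolding EF by auto
      then obtain w where "e = {v, w}" "w \<noteq> v" by (auto simp: card_2_iff doubleton_eq_iff)
      then show "e \<in> (\<lambda>w. {v, w}) ` N v" using e unfolding N_def by blast
    next
      fix e assume "e \<in> (\<lambda>w. {v, w}) ` N v"
      then obtain w where "e = {v, w}" "w \<in> S" "w \<noteq> v" "{v, w} \<notin> F" unfolding N_def by blast
      then show "e \<in> {e \<in> edges C. v \<in> e}" using that unfolding EF by auto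
    qed
    moreover have "inj_on (\<lambda>w. {v, w}) (N v)"
      by (auto simp: inj_on_def doubleton_eq_iff)
    ultimately show ?thesis by (simp add: degree_def card_image)
  qed
  have F: "{v, w} \<in> F \<longleftrightarrow> (v = p0 \<and> w = p1 \<or> v = p1 \<and> w = p0) \<or> (v = p1 \<and> w = p2 \<or> v = p2 \<and> w = p1)
     \<or> (v = q0 \<and> w = q1 \<or> v = q1 \<and> w = q0) \<or> (v = q1 \<and> w = q2 \<or> v = q2 \<and> w = q1)
     \<or> (v = r0 \<and> w = r1 \<or> v = r1 \<and> w = r0) \<or> (v = r1 \<and> w = r2 \<or> v = r2 \<and> w = r1)" for v w
    by (simp add: F_def doubleton_eq_iff)
  have N: "N p0 = S - {p0, p1}" "N p1 = S - {p0, p1, p2}" "N p2 = S - {p1, p2}"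
    "N q0 = S - {q0, q1}" "N q1 = S - {q0, q1, q2}" "N q2 = S - {q1, q2}"
    "N r0 = S - {r0, r1}" "N r1 = S - {r0, r1, r2}" "N r2 = S - {r1, r2}"
    unfolding N_def F set_eq_iff Diff_iff mem_Collect_eq insert_iff empty_iff
    using d by (simp_all, (metis)+)
  have c7: "card (S - {x, y}) = 7" if "x \<in> S" "y \<in> S" "x \<noteq> y" for x y
    using that S(2) fin by (simp add: card_Diff_subset)
  have c6: "card (S - {x, y, z}) = 6"
    if "x \<in> S" "y \<in> S" "z \<in> S" "x \<noteq> y" "x \<noteq> z" "y \<noteq> z" for x y z
    using that S(2) fin by (simp add: card_Diff_subset)
  have mem: "p0 \<in> S" "p1 \<in> S" "p2 \<in> S" "q0 \<in> S" "q1 \<in> S" "q2 \<in> S" "r0 \<in> S" "r1 \<in> S" "r2 \<in> S"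
    using sub by simp_all
  have six: "degree C p1 = 6" "degree C q1 = 6" "degree C r1 = 6"
    using d by (simp_all add: deg mem N c6 S(2))
  have seven: "degree C p0 = 7" "degree C p2 = 7" "degree C q0 = 7" "degree C q2 = 7"
     "degree C r0 = 7" "degree C r2 = 7"
    using d by (simp_all add: deg mem N c7 S(2))
  show ?thesis
  proof (intro equalityI subsetI)
    fix v assume "v \<in> deg6_verts C"
    then have "v \<in> {p0, p1, p2, q0, q1, q2, r0, r1, r2}" "degree C v = 6"
      using S(1) Sv by (simp_all add: deg6_verts_def)
    then show "v \<in> {p1, q1, r1}" using seven by auto
  next
    fix v assume "v \<in> {p1, q1, r1}"
    then show "v \<in> deg6_verts C" using six mem S(1) by (auto simp: deg6_verts_def)
  qed
qed

lemma is_G8_simple: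
  assumes "is_G8 G"
  shows "simple_graph G"
proof -
  obtain S \<C> a where S: "card S = 5" and fC: "finite \<C>"
    and P8: "\<forall>C\<in>\<C>. is_P8 C \<and> verts C \<inter> S = {}"
    and a: "\<forall>C\<in>\<C>. \<forall>v\<in>deg6_verts C. a v \<in> S"
    and V: "verts G = S \<union> (\<Union>C\<in>\<C>. verts C)"
    and E: "edges G = edges (complete_graph S) \<union> (\<Union>C\<in>\<C>. edges C)
                \<union> (\<Union>C\<in>\<C>. {{v, a v} |v. v \<in> deg6_verts C})"
    using assms unfolding is_G8_def by (elim exE conjE) (rule that)
  have "finite S" using S card.infinite by force
  moreover have "finite (verts C)" if "C \<in> \<C>" for C
    using P8 that card.infinite unfolding is_P8_def by force
  ultimately have "finite (verts G)" using fC V by simp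
  moreover have "e \<subseteq> verts G \<and> card e = 2" if "e \<in> edges G" for e
    using that unfolding E
  proof (elim UnE UN_E)
    assume "e \<in> edges (complete_graph S)"
    then show ?thesis using V by (auto simp: complete_graph_def)
  next
    fix C assume C: "C \<in> \<C>" "e \<in> edges C"
    then have "e \<in> edges (complete_graph (verts C))" using P8 unfolding is_P8_def by blast
    then show ?thesis using V C(1) by (auto simp: complete_graph_def)
  next
    fix C assume C: "C \<in> \<C>" "e \<in> {{v, a v} |v. v \<in> deg6_verts C}"
    then obtain v where v: "e = {v, a v}" "v \<in> deg6_verts C" by auto
    have 1: "v \<in> verts C" using v(2) by (simp add: deg6_verts_def)
    have 2: "a v \<in> S" using v(2) a C(1) by simp
    have "verts C \<inter> S = {}" using P8 C(1) by simp
    then have "v \<noteq> a v" using 1 2 by (metis disjoint_iff)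
    moreover have "e \<subseteq> verts G" using 1 2 C(1) v(1) V by simp blast
    ultimately show ?thesis using v(1) by simp
  qed
  ultimately show ?thesis unfolding simple_graph_def by blast
qed

end

theory Submission
  imports Defs
begin

text \<open>
  Each copy of \<open>P\<^sub>8\<close> is separated from the rest of the graph by only three edges, so the eight
  branch vertices of an immersed \<open>K\<^sub>8\<close> all lie in one copy \<open>C\<close> (the \<open>K\<^sub>5\<close> is too small to contain
  them). Hence at most one of the three middle vertices of \<open>C\<close> is not a branch vertex. A middle
  vertex \<open>m\<close> that is a branch vertex has degree 7 in the whole graph, so each edge at \<open>m\<close> is the only
  edge at \<open>m\<close> of one of the seven paths that end there. In particular the path for two middle branch
  vertices \<open>m\<close>, \<open>m'\<close> uses the edge \<open>mm'\<close>, hence contains neither of the edges leaving \<open>C\<close> at \<open>m\<close>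
  and \<open>m'\<close>. But the path through the edge leaving \<open>C\<close> at \<open>m\<close> must come back to \<open>C\<close> by another of the
  three edges. That one can only belong to the single middle vertex that is not a branch vertex, and
  two paths compete for it.
\<close>

section \<open>Edge counts\<close>

lemma card_edges_at_complete_graph:
  assumes "v \<in> S"
  shows "card {e \<in> edges (complete_graph S). v \<in> e} = card S - 1"
proof -
  have "{e \<in> edges (complete_graph S). v \<in> e} = (\<lambda>w. {v, w}) ` (S - {v})"
    using assms by (auto simp: complete_graph_def card_2_iff)
  moreover have "inj_on (\<lambda>w. {v, w}) (S - {v})"
    by (auto simp: inj_on_def doubleton_eq_iff)
  ultimately show ?thesis using assms by (simp add: card_image)
qed

lemma simple_graph_finite_edges:
  assumes "simple_graph G"
  shows "finite (edges G)"
proof (rule finite_subset)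
  show "edges G \<subseteq> Pow (verts G)" using assms by (auto simp: simple_graph_def)
  show "finite (Pow (verts G))" using assms by (simp add: simple_graph_def)
qed

section \<open>Disjoint families and cuts\<close>

lemma disjoint_transversal:
  assumes "finite D" and ne: "\<And>e. e \<in> T \<Longrightarrow> F e \<inter> D \<noteq> {}"
    and dj: "\<And>e f. e \<in> T \<Longrightarrow> f \<in> T \<Longrightarrow> e \<noteq> f \<Longrightarrow> F e \<inter> F f = {}"
  obtains g where "inj_on g T" "g ` T \<subseteq> D" "\<And>e. e \<in> T \<Longrightarrow> g e \<in> F e"
proof -
  have "\<forall>e\<in>T. \<exists>x. x \<in> F e \<inter> D" using ne by blast
  then obtain g where g: "\<And>e. e \<in> T \<Longrightarrow> g e \<in> F e \<inter> D" by metis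
  have "inj_on g T"
  proof (rule inj_onI, rule ccontr)
    fix e f assume "e \<in> T" "f \<in> T" "g e = g f" "e \<noteq> f"
    then show False using g[of e] g[of f] dj[of e f] by auto
  qed
  then show thesis using that g by blast
qed

lemma disjoint_family_card_le:
  assumes "finite D" and "\<And>e. e \<in> T \<Longrightarrow> F e \<inter> D \<noteq> {}"
    and "\<And>e f. e \<in> T \<Longrightarrow> f \<in> T \<Longrightarrow> e \<noteq> f \<Longrightarrow> F e \<inter> F f = {}"
  shows "card T \<le> card D"
proof -
  obtain g where "inj_on g T" "g ` T \<subseteq> D"
    by (rule disjoint_transversal[of D T F]) (use assms in auto)
  then show ?thesis using assms(1) by (rule card_inj_on_le)
qed

text \<open>Choosing one element of \<open>D\<close> from each member gives an injection into
  \<open>D\<close>, which is onto because \<open>D\<close> is no larger than \<open>T\<close>. A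
  second element of \<open>F e \<inter> D\<close> would be \<open>g f\<close> for another
  \<open>f\<close>, against disjointness.\<close>

lemma disjoint_family_tight:
  assumes fin: "finite D" and "\<And>e. e \<in> T \<Longrightarrow> F e \<inter> D \<noteq> {}"
    and dj: "\<And>e f. e \<in> T \<Longrightarrow> f \<in> T \<Longrightarrow> e \<noteq> f \<Longrightarrow> F e \<inter> F f = {}"
    and le: "card D \<le> card T"
  obtains g where "g ` T = D" "\<And>e. e \<in> T \<Longrightarrow> F e \<inter> D = {g e}"
proof -
  obtain g where g: "inj_on g T" "g ` T \<subseteq> D" "\<And>e. e \<in> T \<Longrightarrow> g e \<in> F e"
    by (rule disjoint_transversal[of D T F]) (use assms in auto)
  have im: "g ` T = D"
    using card_seteq[OF fin g(2)] le card_image[OF g(1)] by simp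
  have "F e \<inter> D = {g e}" if e: "e \<in> T" for e
  proof -
    have "x = g e" if "x \<in> F e" "x \<in> D" for x
    proof -
      obtain f where "f \<in> T" "x = g f" using \<open>x \<in> D\<close> im by blast
      then show ?thesis using dj[OF e, of f] g(3)[of f] \<open>x \<in> F e\<close> by blast
    qed
    then show ?thesis using g(3)[OF e] g(2) e by blast
  qed
  with im show thesis by (rule that)
qed

text \<open>When edges have two ends, this is the edge boundary of \<open>X\<close>.\<close>

definition cut_edges :: "'a ugraph \<Rightarrow> 'a set \<Rightarrow> 'a set set" where
  "cut_edges G X = {e \<in> edges G. e \<inter> X \<noteq> {} \<and> e - X \<noteq> {}}"

lemma nat_change_point:
  assumes "i \<le> j" "Q i" "\<not> Q (j::nat)"
  obtains k where "i \<le> k" "k < j" "Q k" "\<not> Q (Suc k)"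
  using assms
proof (induction j arbitrary: thesis rule: dec_induct)
  case (step n)
  then show ?case by (metis le_eq_less_or_eq less_Suc_eq)
qed simp

lemma path_crosses_cut:
  assumes "path_between G p x y" "x \<in> X" "y \<notin> X"
  shows "path_edges p \<inter> cut_edges G X \<noteq> {}"
proof -
  have p: "p \<noteq> []" "path_edges p \<subseteq> edges G" "{hd p, last p} = {x, y}"
    using assms(1) by (auto simp: path_between_def is_path_def)
  \<comment> \<open>\<open>path_between\<close> fixes the ends only as an unordered pair, so sides
    are compared with that of \<open>hd p\<close>; this covers both directions of travel.\<close>
  define Q where "Q i \<longleftrightarrow> (p ! i \<in> X \<longleftrightarrow> hd p \<in> X)" for i
  have "Q 0" using p(1) by (simp add: Q_def hd_conv_nth)
  moreover have "\<not> Q (length p - 1)"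
    using p assms(2,3) by (auto simp: Q_def last_conv_nth doubleton_eq_iff)
  ultimately obtain k where k: "k < length p - 1" "Q k" "\<not> Q (Suc k)"
    using nat_change_point[of 0 "length p - 1" Q] by auto
  have "{p ! k, p ! Suc k} \<in> path_edges p" using k(1) by (auto simp: path_edges_def)
  moreover from this have "{p ! k, p ! Suc k} \<in> cut_edges G X"
    using k(2,3) p(2) by (auto simp: Q_def cut_edges_def)
  ultimately show ?thesis by blast
qed

lemma path_recrosses_cut:
  assumes p: "path_between G p x y" and xy: "x \<in> X" "y \<in> X"
    and e: "e \<in> path_edges p" "e \<in> cut_edges G X"
  obtains f where "f \<in> path_edges p" "f \<in> cut_edges G X" "f \<noteq> e"
proof -
  have p': "p \<noteq> []" "distinct p" "path_edges p \<subseteq> edges G" "hd p \<in> X" "last p \<in> X"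
    using p xy by (auto simp: path_between_def is_path_def doubleton_eq_iff)
  obtain i where i: "Suc i < length p" "e = {p ! i, p ! Suc i}"
    using e(1) by (auto simp: path_edges_def)
  obtain k where k: "k \<noteq> i" "Suc k < length p" "p ! k \<in> X \<longleftrightarrow> p ! Suc k \<notin> X"
  \<comment> \<open>An edge traversed out of \<open>X\<close> is followed by a return, since
    \<open>last p\<close> is in \<open>X\<close>; one traversed into \<open>X\<close> is preceded by
    a departure, since \<open>hd p\<close> is in \<open>X\<close>.\<close>
  proof (cases "p ! i \<in> X")
    case True
    then have "p ! Suc i \<notin> X" using e(2) i by (auto simp: cut_edges_def)
    moreover have "p ! (length p - 1) \<in> X" using p' by (simp add: last_conv_nth)
    moreover have "Suc i \<le> length p - 1" using i(1) by simp
    ultimately obtain k where "Suc i \<le> k" "k < length p - 1" "p ! k \<notin> X" "\<not> p ! Suc k \<notin> X"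
      using nat_change_point[of "Suc i" "length p - 1" "\<lambda>j. p ! j \<notin> X"] by blast
    then show thesis using that[of k] by simp
  next
    case False
    moreover have "p ! 0 \<in> X" using p' by (simp add: hd_conv_nth)
    ultimately obtain k where "k < i" "p ! k \<in> X" "p ! Suc k \<notin> X"
      using nat_change_point[of 0 i "\<lambda>j. p ! j \<in> X"] by blast
    then show thesis using that[of k] i(1) by simp
  qed
  \<comment> \<open>Vertices of a path do not repeat, so different positions carry different
    edges.\<close>
  have "{p ! k, p ! Suc k} \<noteq> e"
    using i k(1,2) p'(2) by (auto simp: doubleton_eq_iff nth_eq_iff_index_eq)
  moreover have "{p ! k, p ! Suc k} \<in> path_edges p" using k(2) by (auto simp: path_edges_def)
  moreover from this have "{p ! k, p ! Suc k} \<in> cut_edges G X"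
    using k(3) p'(3) by (auto simp: cut_edges_def)
  ultimately show thesis using that by blast
qed

section \<open>Immersions of complete graphs\<close>

locale complete_immersion =
  fixes B :: "'b set" and G :: "'a ugraph" and \<phi> :: "'b \<Rightarrow> 'a" and P :: "'b set \<Rightarrow> 'a list"
  assumes finite_edges: "finite (edges G)"
    and inj: "inj_on \<phi> B"
    and path: "u \<in> B \<Longrightarrow> v \<in> B \<Longrightarrow> u \<noteq> v \<Longrightarrow> path_between G (P {u, v}) (\<phi> u) (\<phi> v)"
    and disjoint: "e \<in> edges (complete_graph B) \<Longrightarrow> f \<in> edges (complete_graph B) \<Longrightarrow> e \<noteq> f
      \<Longrightarrow> path_edges (P e) \<inter> path_edges (P f) = {}"
begin

lemma pair_edge: "u \<in> B \<Longrightarrow> v \<in> B \<Longrightarrow> u \<noteq> v \<Longrightarrow> {u, v} \<in> edges (complete_graph B)"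
  by (simp add: complete_graph_def)

text \<open>The (n-1)-edge-connectivity of K_n, carried over to immersions: at least
  \<open>card B - 1\<close> pairs of branch vertices are separated by \<open>X\<close>, and each of
  their edge-disjoint paths needs its own edge of the cut.\<close>

lemma card_cut_ge:
  assumes "u \<in> B" "v \<in> B" "\<phi> u \<in> X" "\<phi> v \<notin> X"
  shows "card B - 1 \<le> card (cut_edges G X)"
proof -
  \<comment> \<open>Each \<open>w\<close> other than \<open>u\<close> is paired with whichever of
    \<open>u\<close>, \<open>v\<close> lies on the other side of \<open>X\<close>;
    \<open>w = v\<close> itself yields \<open>{u, v}\<close>.\<close>
  define h where "h w = (if \<phi> w \<in> X then {v, w} else {u, w})" for w
  have inj_h: "inj_on h (B - {u})"
    by (rule inj_onI) (auto simp: h_def doubleton_eq_iff split: if_splits)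
  have ed: "h w \<in> edges (complete_graph B)" if "w \<in> B - {u}" for w
    using that assms pair_edge[of u w] pair_edge[of v w] by (auto simp: h_def)
  have "card (h ` (B - {u})) \<le> card (cut_edges G X)"
  proof (rule disjoint_family_card_le[where F = "\<lambda>e. path_edges (P e)"])
    show "finite (cut_edges G X)" using finite_edges by (simp add: cut_edges_def)
    show "path_edges (P e) \<inter> cut_edges G X \<noteq> {}" if e: "e \<in> h ` (B - {u})" for e
    proof -
      obtain w where w: "w \<in> B" "w \<noteq> u" "e = h w" using e by blast
      show ?thesis
      proof (cases "\<phi> w \<in> X")
        case True
        then have "w \<noteq> v" using assms by blast
        then show ?thesis
          using path_crosses_cut[of G "P {w, v}" "\<phi> w" "\<phi> v" X] path[of w v] w assms True
          by (simp add: h_def insert_commute)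
      next
        case False
        then show ?thesis
          using path_crosses_cut[of G "P {u, w}" "\<phi> u" "\<phi> w" X] path[of u w] w assms
          by (simp add: h_def)
      qed
    qed
    show "path_edges (P e) \<inter> path_edges (P f) = {}"
      if "e \<in> h ` (B - {u})" "f \<in> h ` (B - {u})" "e \<noteq> f" for e f
      using that ed disjoint[of e f] by blast
  qed
  then show ?thesis using assms(1) card_image[OF inj_h] by simp
qed

text \<open>The degree hypothesis forces equality, so that every edge at \<open>\<phi> u\<close> starts exactly one path.\<close>
lemma saturated:
  assumes u: "u \<in> B" and deg: "degree G (\<phi> u) \<le> card B - 1"
    and simple: "\<And>e. e \<in> edges G \<Longrightarrow> card e = 2"
    and d: "d \<in> edges G" "\<phi> u \<in> d"
  obtains w where "w \<in> B" "w \<noteq> u" "{e \<in> path_edges (P {u, w}). \<phi> u \<in> e} = {d}"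
proof -
  define T where "T = {e \<in> edges (complete_graph B). u \<in> e}"
  define D where "D = {e \<in> edges G. \<phi> u \<in> e}"
  have cT: "card T = card B - 1" unfolding T_def by (rule card_edges_at_complete_graph[OF u])
  have T: "\<exists>w\<in>B. w \<noteq> u \<and> e = {u, w}" if "e \<in> T" for e
    using that u by (auto simp: T_def complete_graph_def card_2_iff)
  \<comment> \<open>The star at \<open>\<phi> u\<close> is a cut, because an edge with two ends
    cannot lie inside one vertex; hence every path ending at \<open>\<phi> u\<close> meets
    it.\<close>
  have cut: "cut_edges G {\<phi> u} = D"
  proof -
    have "e - {\<phi> u} \<noteq> {}" if "e \<in> edges G" for e
    proof
      assume "e - {\<phi> u} = {}"
      then have "card e \<le> 1" using card_mono[of "{\<phi> u}" e] by simp
      then show False using simple[OF that] by simp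
    qed
    then show ?thesis by (auto simp: cut_edges_def D_def)
  qed
  obtain g where g: "g ` T = D" "\<And>e. e \<in> T \<Longrightarrow> path_edges (P e) \<inter> D = {g e}"
  proof (rule disjoint_family_tight[where F = "\<lambda>e. path_edges (P e)"])
    show "finite D" using finite_edges by (simp add: D_def)
    show "path_edges (P e) \<inter> D \<noteq> {}" if e: "e \<in> T" for e
    proof -
      obtain w where w: "w \<in> B" "w \<noteq> u" "e = {u, w}" using T[OF e] by blast
      then have "\<phi> w \<noteq> \<phi> u" using inj u by (auto dest: inj_onD)
      then show ?thesis
        using path_crosses_cut[of G "P {u, w}" "\<phi> u" "\<phi> w" "{\<phi> u}"] path[of u w] w u cut by simp
    qed
    show "path_edges (P e) \<inter> path_edges (P f) = {}" if "e \<in> T" "f \<in> T" "e \<noteq> f" for e f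
      using that disjoint[of e f] by (simp add: T_def)
    show "card D \<le> card T" using deg cT by (simp add: degree_def D_def)
  qed blast
  obtain e where e: "e \<in> T" "d = g e" using d g(1) by (auto simp: D_def)
  obtain w where w: "w \<in> B" "w \<noteq> u" "e = {u, w}" using T[OF e(1)] by blast
  have "path_edges (P e) \<subseteq> edges G"
    using path[of u w] w u by (simp add: path_between_def is_path_def)
  then have "{f \<in> path_edges (P e). \<phi> u \<in> f} = path_edges (P e) \<inter> D" by (auto simp: D_def)
  then show thesis using that w g(2)[OF e(1)] e(2) by simp
qed

end

section \<open>The graph \<open>P\<^sub>8\<close>\<close>

text \<open>Coordinates for P_8, with \<open>p1\<close>, \<open>q1\<close>, \<open>r1\<close> the
  middle vertices, so that adjacency and degrees can be settled by cases.\<close>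

lemma P8_obtain:
  assumes "is_P8 C"
  obtains p0 p1 p2 q0 q1 q2 r0 r1 r2 where
    "distinct [p0, p1, p2, q0, q1, q2, r0, r1, r2]"
    "verts C = {p0, p1, p2, q0, q1, q2, r0, r1, r2}"
    "edges C = edges (complete_graph (verts C))
       - {{p0, p1}, {p1, p2}, {q0, q1}, {q1, q2}, {r0, r1}, {r1, r2}}"
    "deg6_verts C = {p1, q1, r1}"
proof -
  obtain p q r where c: "card (verts C) = 9"
    and s: "\<forall>s\<in>{p, q, r}. is_path (complete_graph (verts C)) s \<and> length s = 3"
    and dj: "set p \<inter> set q = {}" "set p \<inter> set r = {}" "set q \<inter> set r = {}"
    and E: "edges C = edges (complete_graph (verts C))
      - (path_edges p \<union> path_edges q \<union> path_edges r)"
    using assms unfolding is_P8_def by (elim exE conjE) (rule that)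
  have len: "\<exists>x y z. s = [x, y, z]" if "length s = 3" for s :: "'a list"
    using that by (auto simp: numeral_3_eq_3 length_Suc_conv)
  obtain p0 p1 p2 where p: "p = [p0, p1, p2]" using s len[of p] by auto
  obtain q0 q1 q2 where q: "q = [q0, q1, q2]" using s len[of q] by auto
  obtain r0 r1 r2 where r: "r = [r0, r1, r2]" using s len[of r] by auto
  have d: "distinct [p0, p1, p2, q0, q1, q2, r0, r1, r2]"
    using s dj by (auto simp: p q r is_path_def)
  have sub: "{p0, p1, p2, q0, q1, q2, r0, r1, r2} \<subseteq> verts C"
    using s by (auto simp: p q r is_path_def complete_graph_def)
  have fin: "finite (verts C)" using c card.infinite by force
  have V: "verts C = {p0, p1, p2, q0, q1, q2, r0, r1, r2}"
    using card_subset_eq[OF fin sub] c d by simp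
  have pe: "path_edges [x, y, z] = {{x, y}, {y, z}}" for x y z :: 'a
    by (auto simp: path_edges_def less_Suc_eq conj_disj_distribL ex_disj_distrib)
  have "deg6_verts C = {p1, q1, r1}"
    using P8_deg6_verts[OF refl c d sub] E by (simp add: p q r)
  moreover have "edges C = edges (complete_graph (verts C))
       - {{p0, p1}, {p1, p2}, {q0, q1}, {q1, q2}, {r0, r1}, {r1, r2}}"
    using E by (simp add: p q r pe insert_commute Un_assoc)
  ultimately show thesis by (intro that[OF d V])
qed

lemma P8_card_deg6: "is_P8 C \<Longrightarrow> card (deg6_verts C) = 3"
  by (erule P8_obtain) simp

text \<open>Every deleted edge joins a middle vertex to an end of its own path, so none joins two
  middle vertices.\<close>

lemma P8_deg6_adjacent:
  assumes "is_P8 C" "m \<in> deg6_verts C" "m' \<in> deg6_verts C" "m \<noteq> m'"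
  shows "{m, m'} \<in> edges C"
  using assms(1)
proof (cases rule: P8_obtain)
  case 1
  then show ?thesis using assms(2-4)
    by (auto simp: complete_graph_def doubleton_eq_iff)
qed

lemma P8_edges: "is_P8 C \<Longrightarrow> e \<in> edges C \<Longrightarrow> e \<subseteq> verts C \<and> card e = 2"
  by (auto simp: is_P8_def complete_graph_def)

lemma P8_finite_edges:
  assumes "is_P8 C"
  shows "finite (edges C)"
proof (rule finite_subset)
  show "edges C \<subseteq> Pow (verts C)" using P8_edges[OF assms] by blast
  have "card (verts C) = 9" using assms by (simp add: is_P8_def)
  then show "finite (Pow (verts C))" using card.infinite by fastforce
qed

lemma P8_degree_ge:
  assumes C: "is_P8 C" and v: "v \<in> verts C" "v \<notin> deg6_verts C"
  shows "degree C v \<ge> 7"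
  using C
proof (cases rule: P8_obtain)
  case (1 p0 p1 p2 q0 q1 q2 r0 r1 r2)
  define F where "F = {{p0, p1}, {p1, p2}, {q0, q1}, {q1, q2}, {r0, r1}, {r1, r2}}"
  have "v \<in> {p0, p2, q0, q2, r0, r2}" using v 1(2,4) by auto
  \<comment> \<open>Only a middle vertex lies on two deleted edges; any other vertex loses just one
    of its eight edges of K_9.\<close>
  then have "\<exists>f. {e \<in> F. v \<in> e} \<subseteq> {f}"
    using 1(1) unfolding F_def by (elim insertE emptyE) auto
  then obtain f where f: "{e \<in> F. v \<in> e} \<subseteq> {f}" ..
  have "{e \<in> edges (complete_graph (verts C)). v \<in> e} - {f} \<subseteq> {e \<in> edges C. v \<in> e}"
    using f 1(3)[folded F_def] by blast
  moreover have "finite {e \<in> edges C. v \<in> e}" using P8_finite_edges[OF C] by simp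
  ultimately have "card ({e \<in> edges (complete_graph (verts C)). v \<in> e} - {f}) \<le> degree C v"
    unfolding degree_def by (rule card_mono[rotated])
  moreover have "card {e \<in> edges (complete_graph (verts C)). v \<in> e} = 8"
    using card_edges_at_complete_graph[OF v(1)] C by (simp add: is_P8_def)
  ultimately show ?thesis
    using diff_card_le_card_Diff[of "{f}" "{e \<in> edges (complete_graph (verts C)). v \<in> e}"] by simp
qed

section \<open>The graphs \<open>G\<^sub>8\<close>\<close>

text \<open>Finiteness of the family of copies enters through \<open>simple\<close>, which
  \<open>is_G8_simple\<close> supplies.\<close>

locale G8 =
  fixes G :: "'a ugraph" and S :: "'a set" and \<C> :: "'a ugraph set" and a :: "'a \<Rightarrow> 'a"
  assumes card_S: "card S = 5"
    and P8: "C \<in> \<C> \<Longrightarrow> is_P8 C"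
    and disj_S: "C \<in> \<C> \<Longrightarrow> verts C \<inter> S = {}"
    and disj: "C \<in> \<C> \<Longrightarrow> D \<in> \<C> \<Longrightarrow> C \<noteq> D \<Longrightarrow> verts C \<inter> verts D = {}"
    and a_in: "C \<in> \<C> \<Longrightarrow> v \<in> deg6_verts C \<Longrightarrow> a v \<in> S"
    and V: "verts G = S \<union> (\<Union>C\<in>\<C>. verts C)"
    and E: "edges G = edges (complete_graph S) \<union> (\<Union>C\<in>\<C>. edges C)
                \<union> (\<Union>C\<in>\<C>. {{v, a v} |v. v \<in> deg6_verts C})"
    and deg_S: "v \<in> S \<Longrightarrow> degree G v \<ge> 7"
    and simple: "simple_graph G"
begin

text \<open>Edges of the K_5 and of the other copies miss \<open>verts C\<close>, and so do the
  attaching edges of other copies, whose far ends lie in \<open>S\<close>.\<close>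

lemma edge_meeting_copy:
  assumes C: "C \<in> \<C>" and e: "e \<in> edges G" "e \<inter> verts C \<noteq> {}"
  shows "e \<in> edges C \<or> (\<exists>v\<in>deg6_verts C. e = {v, a v})"
  using e(1) unfolding E
proof (elim UnE UN_E)
  assume "e \<in> edges (complete_graph S)"
  then show ?thesis using e(2) disj_S[OF C] by (auto simp: complete_graph_def)
next
  fix D assume D: "D \<in> \<C>" "e \<in> edges D"
  then have "D = C" using disj[OF C D(1)] e(2) P8_edges[OF P8[OF D(1)] D(2)] by blast
  then show ?thesis using D by simp
next
  fix D assume D: "D \<in> \<C>" "e \<in> {{v, a v} |v. v \<in> deg6_verts D}"
  then obtain v where v: "e = {v, a v}" "v \<in> deg6_verts D" by blast
  then have "v \<in> verts D" "a v \<notin> verts C"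
    using a_in[OF D(1)] disj_S[OF C] by (auto simp: deg6_verts_def)
  then have "D = C" using disj[OF C D(1)] e(2) v by blast
  then show ?thesis using v by blast
qed

lemma out_edge:
  assumes "C \<in> \<C>" "v \<in> deg6_verts C"
  shows "{v, a v} \<in> edges G" "v \<in> verts C" "a v \<notin> verts C"
  using assms a_in[OF assms] disj_S[OF assms(1)] by (auto simp: E deg6_verts_def)

text \<open>Besides bounding the cut, this labels each of its edges by a middle vertex, which is how
  a returning path is traced.\<close>

lemma cut_copy:
  assumes C: "C \<in> \<C>"
  shows "cut_edges G (verts C) = (\<lambda>v. {v, a v}) ` deg6_verts C"
proof
  show "cut_edges G (verts C) \<subseteq> (\<lambda>v. {v, a v}) ` deg6_verts C"
    using edge_meeting_copy[OF C] P8_edges[OF P8[OF C]] by (fastforce simp: cut_edges_def)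
  show "(\<lambda>v. {v, a v}) ` deg6_verts C \<subseteq> cut_edges G (verts C)"
    using out_edge[OF C] by (auto simp: cut_edges_def)
qed

lemma card_cut_copy_le:
  assumes "C \<in> \<C>"
  shows "card (cut_edges G (verts C)) \<le> 3"
  unfolding cut_copy[OF assms] using P8_card_deg6[OF P8[OF assms]]
  by (metis card_image_le card.infinite zero_neq_numeral)

text \<open>Six edges inside the copy and one leaving it. As 7 is one less than the order of K_8,
  \<open>saturated\<close> applies at middle vertices that are branch vertices.\<close>

lemma degree_deg6:
  assumes C: "C \<in> \<C>" and m: "m \<in> deg6_verts C"
  shows "degree G m = 7"
proof -
  have ev: "e \<in> edges G \<and> m \<in> e \<longleftrightarrow> e = {m, a m} \<or> (e \<in> edges C \<and> m \<in> e)" for e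
  proof -
    have "e = {m, a m}" if "v \<in> deg6_verts C" "e = {v, a v}" "m \<in> e" for v
      using that out_edge[OF C that(1)] out_edge[OF C m] by auto
    moreover have "edges C \<subseteq> edges G" using C by (auto simp: E)
    ultimately show ?thesis
      using edge_meeting_copy[OF C, of e] out_edge[OF C m] by blast
  qed
  have eq: "{e \<in> edges G. m \<in> e} = insert {m, a m} {e \<in> edges C. m \<in> e}"
    using ev by blast
  have "{m, a m} \<notin> edges C" using P8_edges[OF P8[OF C], of "{m, a m}"] out_edge[OF C m] by auto
  then show ?thesis using m P8_finite_edges[OF P8[OF C]]
    unfolding degree_def eq by (simp add: deg6_verts_def degree_def)
qed

section \<open>Minimum degree of G_8\<close>

lemma degree_ge:
  assumes "v \<in> verts G"
  shows "degree G v \<ge> 7"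
proof (cases "v \<in> S")
  case False
  then obtain C where C: "C \<in> \<C>" "v \<in> verts C" using assms V by blast
  show ?thesis
  proof (cases "v \<in> deg6_verts C")
    case False
    have "edges C \<subseteq> edges G" using C(1) by (auto simp: E)
    then have "degree C v \<le> degree G v" unfolding degree_def
      using simple_graph_finite_edges[OF simple] by (intro card_mono) auto
    then show ?thesis using P8_degree_ge[OF P8[OF C(1)] C(2) False] by simp
  qed (use degree_deg6[OF C(1)] in simp)
qed (rule deg_S)

text \<open>In K_5 alone all degrees are 4. A copy provides the middle vertex at which the minimum 7
  is attained.\<close>

lemma copies_nonempty: "\<C> \<noteq> {}"
proof
  assume "\<C> = {}"
  moreover obtain v where v: "v \<in> S" using card_S by fastforce
  ultimately have "degree G v = 4"
    using card_edges_at_complete_graph[OF v] card_S by (simp add: degree_def E)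
  then show False using deg_S[OF v] by simp
qed

lemma min_degree: "min_degree G = 7"
proof -
  obtain C where C: "C \<in> \<C>" using copies_nonempty by blast
  have "deg6_verts C \<noteq> {}" using P8_card_deg6[OF P8[OF C]] by auto
  then obtain m where m: "m \<in> deg6_verts C" by blast
  have "m \<in> verts G" using m C V by (auto simp: deg6_verts_def)
  then show ?thesis unfolding min_degree_def
    using degree_ge degree_deg6[OF C m] simple
    by (intro Min_eqI) (auto simp: simple_graph_def image_iff intro: sym)
qed

section \<open>Excluding immersions of K_8\<close>

lemma no_immersion_in_copy:
  fixes B :: "'b set"
  assumes imm: "complete_immersion B G \<phi> P" and B: "card B = 8"
    and C: "C \<in> \<C>" and sub: "\<phi> ` B \<subseteq> verts C"
  shows False
proof -
  interpret complete_immersion B G \<phi> P by (rule imm)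
  let ?M = "deg6_verts C"
  have card_V: "card (verts C) = 9" using P8[OF C] by (simp add: is_P8_def)
  then have fin: "finite (verts C)" using card.infinite by force
  have card2: "card e = 2" if "e \<in> edges G" for e
    using that simple by (simp add: simple_graph_def)
  \<comment> \<open>Eight of the nine vertices are branch vertices. The one left over is not assumed
    to be a middle vertex.\<close>
  have card1: "card (verts C - \<phi> ` B) = 1"
    using card_Diff_subset[OF finite_subset[OF sub fin] sub] card_image[OF inj] B card_V by simp
  then obtain x where x: "verts C - \<phi> ` B = {x}" by (auto simp: card_1_singleton_iff)
  have branch: "\<exists>u\<in>B. m = \<phi> u" if "m \<in> ?M" "m \<noteq> x" for m
    using that x by (auto simp: deg6_verts_def)
  have sat: "\<exists>w\<in>B. w \<noteq> u \<and> {e \<in> path_edges (P {u, w}). \<phi> u \<in> e} = {d}"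
    if "u \<in> B" "\<phi> u \<in> ?M" "d \<in> edges G" "\<phi> u \<in> d" for u d
  proof -
    have "degree G (\<phi> u) \<le> card B - 1" using degree_deg6[OF C that(2)] B by simp
    then show ?thesis using saturated[OF that(1) _ card2 that(3,4)] by metis
  qed
  have unique: "e = f" if "e \<in> edges (complete_graph B)" "f \<in> edges (complete_graph B)"
    "d \<in> path_edges (P e)" "d \<in> path_edges (P f)" for d e f
    using that disjoint[of e f] by blast

  have direct: "{e \<in> path_edges (P {u, v}). \<phi> u \<in> e} = {{\<phi> u, \<phi> v}}"
    if uv: "u \<in> B" "v \<in> B" "u \<noteq> v" "\<phi> u \<in> ?M" "\<phi> v \<in> ?M" for u v
  proof -
    have "\<phi> u \<noteq> \<phi> v" using inj uv by (auto dest: inj_onD)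
    then have d: "{\<phi> u, \<phi> v} \<in> edges G"
      using P8_deg6_adjacent[OF P8[OF C] uv(4,5)] C by (auto simp: E)
    obtain w where w: "w \<in> B" "w \<noteq> u" "{e \<in> path_edges (P {u, w}). \<phi> u \<in> e} = {{\<phi> u, \<phi> v}}"
      using sat[OF uv(1,4) d] by auto
    obtain w' where w': "w' \<in> B" "w' \<noteq> v" "{e \<in> path_edges (P {v, w'}). \<phi> v \<in> e} = {{\<phi> u, \<phi> v}}"
      using sat[OF uv(2,5) d] by auto
    \<comment> \<open>Saturation at either end puts the edge between the two middle vertices on a
      path ending there; by edge-disjointness it is one path, so its ends are both of them.\<close>
    have "{u, w} = {v, w'}"
      using unique[of "{u, w}" "{v, w'}"] pair_edge uv w w' by blast
    then have "w = v" using uv(3) by (auto simp: doubleton_eq_iff)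
    then show ?thesis using w by simp
  qed
  have out_edge_not_direct: "{\<phi> u, a (\<phi> u)} \<notin> path_edges (P {u, v})"
    if uv: "u \<in> B" "v \<in> B" "u \<noteq> v" "\<phi> u \<in> ?M" "\<phi> v \<in> ?M" for u v
  proof
    assume "{\<phi> u, a (\<phi> u)} \<in> path_edges (P {u, v})"
    then have "{\<phi> u, a (\<phi> u)} \<in> {e \<in> path_edges (P {u, v}). \<phi> u \<in> e}" by simp
    then have "{\<phi> u, a (\<phi> u)} = {\<phi> u, \<phi> v}" unfolding direct[OF uv] by simp
    then have "a (\<phi> u) \<in> {\<phi> u, \<phi> v}" by (auto simp: doubleton_eq_iff)
    then show False using out_edge[OF C uv(4)] out_edge[OF C uv(5)] by auto
  qed

  have through_x: "\<exists>w\<in>B. w \<noteq> u \<and> {\<phi> u, a (\<phi> u)} \<in> path_edges (P {u, w})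
      \<and> {x, a x} \<in> path_edges (P {u, w})"
    if u: "u \<in> B" "\<phi> u \<in> ?M" for u
  proof -
    let ?o = "{\<phi> u, a (\<phi> u)}"
    obtain w where w: "w \<in> B" "w \<noteq> u" "{e \<in> path_edges (P {u, w}). \<phi> u \<in> e} = {?o}"
      using sat[OF u out_edge(1)[OF C u(2)]] by auto
    then have o: "?o \<in> path_edges (P {u, w})" by blast
    have "?o \<in> cut_edges G (verts C)" using cut_copy[OF C] u(2) by blast
    then obtain f where f: "f \<in> path_edges (P {u, w})" "f \<in> cut_edges G (verts C)" "f \<noteq> ?o"
      using path_recrosses_cut[OF path[OF u(1) w(1) w(2)[symmetric]] _ _ o] sub u(1) w(1) by blast
    then obtain m where m: "m \<in> ?M" "f = {m, a m}" using cut_copy[OF C] by blast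
    \<comment> \<open>Otherwise saturation at the branch vertex \<open>m\<close> makes the path
      through \<open>f\<close> end at \<open>m\<close>, so it joins two middle vertices and cannot
      use the edge leaving \<open>C\<close> at \<open>\<phi> u\<close>.\<close>
    have "m = x"
    proof (rule ccontr)
      assume "m \<noteq> x"
      then obtain v where v: "v \<in> B" "m = \<phi> v" using branch m(1) by blast
      have uv: "v \<noteq> u" using f(3) m(2) v(2) by blast
      obtain w' where w': "w' \<in> B" "w' \<noteq> v" "{e \<in> path_edges (P {v, w'}). \<phi> v \<in> e} = {f}"
        using sat[of v f] v m out_edge[OF C m(1)] by auto
      have "{u, w} = {v, w'}"
        using unique[of "{u, w}" "{v, w'}" f] pair_edge u w w' v f(1) by blast
      then have "w = v" using uv by (auto simp: doubleton_eq_iff)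
      then show False using out_edge_not_direct[of u v] u v uv m(1) o by simp
    qed
    then show ?thesis using w o f(1) m(2) by blast
  qed

  have "card (?M - {x}) \<ge> 2"
    using P8_card_deg6[OF P8[OF C]] diff_card_le_card_Diff[of "{x}" ?M] by simp
  then obtain m m' where m: "m \<in> ?M - {x}" "m' \<in> ?M - {x}" "m \<noteq> m'"
    by (metis card_2_iff obtain_subset_with_card_n insert_subset)
  obtain u where u: "u \<in> B" "m = \<phi> u" using branch m by blast
  obtain v where v: "v \<in> B" "m' = \<phi> v" using branch m by blast
  have uv: "u \<noteq> v" using m(3) u v by blast
  obtain w where w: "w \<in> B" "w \<noteq> u" "{\<phi> u, a (\<phi> u)} \<in> path_edges (P {u, w})"
    "{x, a x} \<in> path_edges (P {u, w})" using through_x[of u] u m by auto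
  obtain w' where w': "w' \<in> B" "w' \<noteq> v" "{x, a x} \<in> path_edges (P {v, w'})"
    using through_x[of v] v m by auto
  \<comment> \<open>The edge \<open>{x, a x}\<close> lies on only one path, so the paths leaving
    \<open>C\<close> at \<open>m\<close> and at \<open>m'\<close> coincide and join these two middle
    vertices.\<close>
  have "{u, w} = {v, w'}"
    using unique[of "{u, w}" "{v, w'}"] pair_edge u v w w' by blast
  then have "w = v" using uv by (auto simp: doubleton_eq_iff)
  then show False using out_edge_not_direct[of u v] u v uv m w(3) by simp
qed

lemma no_immersion:
  fixes B :: "'b set"
  assumes B: "card B = 8"
  shows "\<not> immersed (complete_graph B) G"
proof
  assume "immersed (complete_graph B) G"
  then obtain \<phi> P where inj: "inj_on \<phi> B" and sub: "\<phi> ` B \<subseteq> verts G"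
    and path: "\<forall>u v. {u, v} \<in> edges (complete_graph B) \<longrightarrow> path_between G (P {u, v}) (\<phi> u) (\<phi> v)"
    and dj: "\<forall>e\<in>edges (complete_graph B). \<forall>f\<in>edges (complete_graph B).
      e \<noteq> f \<longrightarrow> path_edges (P e) \<inter> path_edges (P f) = {}"
    by (auto simp: immersed_def complete_graph_def)
  interpret complete_immersion B G \<phi> P
  proof
    show "finite (edges G)" by (rule simple_graph_finite_edges[OF simple])
    show "inj_on \<phi> B" by (rule inj)
    show "path_between G (P {u, v}) (\<phi> u) (\<phi> v)" if "u \<in> B" "v \<in> B" "u \<noteq> v" for u v
      using path that by (simp add: complete_graph_def)
    show "path_edges (P e) \<inter> path_edges (P f) = {}"
      if "e \<in> edges (complete_graph B)" "f \<in> edges (complete_graph B)" "e \<noteq> f" for e f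
      using dj that by blast
  qed
  have "\<not> \<phi> ` B \<subseteq> S"
    using card_mono[of S "\<phi> ` B"] card_S card_image[OF inj] B card.infinite by fastforce
  then obtain u C where u: "u \<in> B" and C: "C \<in> \<C>" "\<phi> u \<in> verts C" using sub V by blast
  \<comment> \<open>Branch vertices on both sides would require 8 - 1 = 7 cut edges, but only three
    edges leave a copy.\<close>
  have "\<phi> ` B \<subseteq> verts C"
  proof (rule ccontr)
    assume "\<not> \<phi> ` B \<subseteq> verts C"
    then obtain v where "v \<in> B" "\<phi> v \<notin> verts C" by blast
    then show False using card_cut_ge[OF u _ C(2)] card_cut_copy_le[OF C(1)] B by fastforce
  qed
  then show False using no_immersion_in_copy complete_immersion_axioms B C(1) by blast
qed

end

theorem theorem4p6:
  fixes G :: "'a ugraph"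
  assumes "is_G8 G"
  shows "min_degree G = 7 \<and> \<not> immersed (complete_graph {..<8::nat}) G"
proof -
  obtain S \<C> a where
    "card S = 5"
    "\<forall>C\<in>\<C>. is_P8 C \<and> verts C \<inter> S = {}"
    "\<forall>C\<in>\<C>. \<forall>D\<in>\<C>. C \<noteq> D \<longrightarrow> verts C \<inter> verts D = {}"
    "\<forall>C\<in>\<C>. \<forall>v\<in>deg6_verts C. a v \<in> S"
    "verts G = S \<union> (\<Union>C\<in>\<C>. verts C)"
    "edges G = edges (complete_graph S) \<union> (\<Union>C\<in>\<C>. edges C)
                \<union> (\<Union>C\<in>\<C>. {{v, a v} |v. v \<in> deg6_verts C})"
    "\<forall>v\<in>S. degree G v \<ge> 7"
    using assms unfolding is_G8_def by (elim exE conjE) (rule that)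
  then interpret G8 G S \<C> a
    by unfold_locales (simp_all add: is_G8_simple[OF assms])
  show ?thesis using min_degree no_immersion[of "{..<8::nat}"] by simp
qed

end
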